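(* Let $(Y,Z)$ be a dual pair of real vector spaces, let $C,D\subseteq Y$ be $\sigma(Y,Z)$-closed cones, and let $B_{1},B_{2}\subseteq Y$ be $\sigma(Y,Z)$-closed convex sets containing zero. (1) Consider the statements: (i) $Y$ is additive with respect to $(C,D,B_{1},B_{2})$. (ii) $Z$ is coadditive with respect to $(C^{\odot},D^{\odot},B_{1}^{\odot},B_{2}^{\odot})$. Then: (a) (ii) implies (i). (b) If $B_{2}^{\odot}+C^{\odot}$ is $\sigma(Z,Y)$-closed, then (i) and (ii) are equivalent. (2) Consider the statements: (i) $Y$ is coadditive with respect to $(C,D,B_{1},B_{2})$. (ii) $Y$ is coadditive with respect to $(C,D,B_{1},\lambda B_{2})$ for all $\lambda>1$. (iii) $Z$ is additive with respect to $(C^{\odot},D^{\odot},B_{1}^{\odot},B_{2}^{\odot})$. Then: (a) (ii) implies (iii). (b) If $B_{2}+C$ is $\sigma(Y,Z)$-cs-closed and $B_{1}$ contains a $\sigma(Y,Z)$-pre-cs-compact set $G$ such that, for every $b\in B_{1}$ and $r>0$, $(b-rG)\cap(B_{2}+C)\neq\emptyset$, then (ii) and (iii) are equivalent. (c) If $B_{2}+C$ is $\sigma(Y,Z)$-closed, then (i), (ii) and (iii) are equivalent.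
   Context: All vector spaces are over $\mathbb{R}$. Dual pair: real vector spaces $Y,Z$ with a bilinear map $\langle\cdot,\cdot\rangle:Y\times Z\to\mathbb{R}$ such that $\{\langle\cdot,z\rangle: z\in Z\}$ separates the points of $Y$ and $\{\langle y,\cdot\rangle: y\in Y\}$ separates the points of $Z$. $\sigma(Y,Z)$ and $\sigma(Z,Y)$ denote the corresponding weak and weak* topologies on $Y$ and $Z$. Cone: a non-empty subset $C$ of a vector space with $C+C\subseteq C$ and $\lambda C\subseteq C$ for all $\lambda\geq0$. One-sided polar: for $A\subseteq Y$, $A^{\odot}:=\{z\in Z:\langle a,z\rangle\leq1\ \forall a\in A\}$. Let $V$ be a vector space, $C,D\subseteq V$ cones, and $B_{1},B_{2}\subseteq V$ convex sets containing zero. Then $V$ is called: - additive with respect to $(C,D,B_{1},B_{2})$ if $(B_{2}\cap C)+D\subseteq B_{1}$; - coadditive with respect to $(C,D,B_{1},B_{2})$ if $B_{1}\subseteq(B_{2}+C)\cap D$. Let $V$ be a topological vector space with topology $\tau$ and $A\subseteq V$. - $A$ is $\tau$-pre-cs-compact if for all sequences $\{a_{n}\}\subseteq A$ and $\{\lambda_{n}\}\subseteq[0,\infty)$ with $\sum_{n=1}^{\infty}\lambda_{n}=1$, the series $\sum_{n=1}^{\infty}\lambda_{n}a_{n}$ converges in the topology $\tau$. - $A$ is $\tau$-cs-closed if for all sequences $\{a_{n}\}\subseteq A$ and $\{\lambda_{n}\}\subseteq[0,\infty)$ with $\sum_{n=1}^{\infty}\lambda_{n}=1$, convergence of $\sum_{n=1}^{\infty}\lambda_{n}a_{n}$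 in the topology $\tau$ implies $\sum_{n=1}^{\infty}\lambda_{n}a_{n}\in A$. *)

theory Defs
  imports "HOL-Analysis.Analysis"
begin

(* Cones are the library's convex_cone; sums B + C of sets are Minkowski sums
   (HOL-Library.Set_Algebras). *)

lemma convex_cone_iff_nonempty_add_scale:
  "convex_cone C \<longleftrightarrow> C \<noteq> {} \<and> C + C \<subseteq> C \<and> (\<forall>l\<ge>0. (*\<^sub>R) l ` C \<subseteq> C)"
proof -
  have "0 \<in> C" if "C \<noteq> {}" "\<forall>l\<ge>0. (*\<^sub>R) l ` C \<subseteq> C"
    using that by (metis (no_types) all_not_in_conv image_subset_iff order_refl scaleR_zero_left)
  then show ?thesis
    unfolding convex_cone_iff by (auto elim!: set_plus_elim simp: set_plus_def image_subset_iff)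
qed

definition dual_pair :: "('y::real_vector \<Rightarrow> 'z::real_vector \<Rightarrow> real) \<Rightarrow> bool" where
  "dual_pair p \<longleftrightarrow> bilinear p \<and>
     (\<forall>y y'. y \<noteq> y' \<longrightarrow> (\<exists>z. p y z \<noteq> p y' z)) \<and>
     (\<forall>z z'. z \<noteq> z' \<longrightarrow> (\<exists>y. p y z \<noteq> p y z'))"

(* weak_topology p is sigma(Y,Z) on Y, the coarsest topology making every p _ z continuous;
   sigma(Z,Y) on Z is obtained from the flipped pairing, weak_topology (\<lambda>z y. p y z). *)
definition weak_topology :: "('y \<Rightarrow> 'z \<Rightarrow> real) \<Rightarrow> 'y topology" where
  "weak_topology p = topology_generated_by {(\<lambda>y. p y z) -` U | z U. open U}"

lemma topspace_weak_topology [simp]: "topspace (weak_topology p) = UNIV"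
proof -
  have "UNIV \<in> {(\<lambda>y. p y z) -` U | z U. open U}"
    by (auto intro!: exI[of _ UNIV])
  then show ?thesis
    unfolding weak_topology_def by (auto simp: topology_generated_by_topspace)
qed

definition one_sided_polar :: "('y \<Rightarrow> 'z \<Rightarrow> real) \<Rightarrow> 'y set \<Rightarrow> 'z set" where
  "one_sided_polar p A = {z. \<forall>a\<in>A. p a z \<le> 1}"

(* In the next two definitions C, D are meant to be cones and B1, B2 convex sets containing zero. *)
definition additive_wrt ::
  "'v::real_vector set \<Rightarrow> 'v set \<Rightarrow> 'v set \<Rightarrow> 'v set \<Rightarrow> bool" where
  "additive_wrt C D B1 B2 \<longleftrightarrow> (B2 \<inter> C) + D \<subseteq> B1"

definition coadditive_wrt ::
  "'v::real_vector set \<Rightarrow> 'v set \<Rightarrow> 'v set \<Rightarrow> 'v set \<Rightarrow> bool" where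
  "coadditive_wrt C D B1 B2 \<longleftrightarrow> B1 \<subseteq> (B2 + C) \<inter> D"

(* These are meant for vector space topologies on the whole type (topspace UNIV).
   Sequences are indexed from 0 instead of 1, so the partial sums run over n < N. *)
definition pre_cs_compact :: "'v::real_vector topology \<Rightarrow> 'v set \<Rightarrow> bool" where
  "pre_cs_compact \<tau> A \<longleftrightarrow>
     (\<forall>a c. (\<forall>n. a n \<in> A) \<and> (\<forall>n. 0 \<le> c n) \<and> c sums (1::real) \<longrightarrow>
        (\<exists>s. limitin \<tau> (\<lambda>N. \<Sum>n<N. c n *\<^sub>R a n) s sequentially))"

definition cs_closed :: "'v::real_vector topology \<Rightarrow> 'v set \<Rightarrow> bool" where
  "cs_closed \<tau> A \<longleftrightarrow>
     (\<forall>a c s. (\<forall>n. a n \<in> A) \<and> (\<forall>n. 0 \<le> c n) \<and> c sums (1::real) \<and>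
        limitin \<tau> (\<lambda>N. \<Sum>n<N. c n *\<^sub>R a n) s sequentially \<longrightarrow> s \<in> A)"

end

theory Submission
  imports Defs
begin

text \<open>Everything rests on the bipolar theorem: a weakly closed convex set \<open>K\<close> containing zero equals
  its bipolar. A point outside \<open>K\<close> has a weak neighbourhood, cut out by finitely many functionals
  \<open>p _ z\<close>, that misses \<open>K\<close>; so the separation takes place in a finite-dimensional
  quotient. There it is obtained from the nearest point of the image of
  \<open>K\<close> (\<open>finite_family_separation\<close>), and the separating functional is a finite combination of the
  \<open>p _ z\<close>, hence itself of this form (\<open>bipolar_eq\<close>).

  Since the pairing with a polar element is at most \<open>1\<close> on a set but at most \<open>0\<close> on a cone,
  polarity turns the sum of a set containing zero and a cone into the intersection of the polars
  (\<open>one_sided_polar_add_cone\<close>). Thus it exchanges the sets \<open>(B2 \<inter> C) + D\<close> and \<open>(B2 + C) \<inter> D\<close> of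
  additivity and coadditivity, up to closures, and reverses the inclusions. All equivalences
  under a closedness hypothesis are this observation together with the bipolar theorem.

  When \<open>S = B2 + C\<close> is only cs-closed, membership in \<open>l S\<close> is produced by iteration
  (\<open>cs_closed_absorbs_dilate\<close>): starting from \<open>b\<close>, write each remainder as an element of \<open>S\<close> plus
  \<open>r\<close> times a new remainder in \<open>G\<close>. The elements of \<open>S\<close> so found form a geometric series with sum \<open>b\<close>,
  because pre-cs-compactness of \<open>G\<close> makes the remainders vanish weakly.\<close>

section \<open>Separation by finitely many functionals\<close>

text \<open>The least-squares argument in the finite-dimensional image of \<open>K\<close> under the family \<open>f\<close>:
  the coefficients \<open>a\<close> are the coordinates, relative to \<open>t\<close>, of the point of the closure of that image that
  is nearest to \<open>t\<close>. The image itself need not be closed, so \<open>a\<close> is a limit along a minimising sequence,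
  which is Cauchy by the parallelogram law.\<close>

lemma finite_family_separation:
  fixes f :: "'i \<Rightarrow> 'v::real_vector \<Rightarrow> real"
  assumes F: "finite F" and lin: "\<And>i. i \<in> F \<Longrightarrow> linear (f i)"
    and K: "convex K" "K \<noteq> {}" and "e > 0"
    and away: "\<And>y. y \<in> K \<Longrightarrow> \<exists>i\<in>F. \<bar>f i y - t i\<bar> \<ge> e"
  obtains a \<delta> where "\<delta> > 0" "\<And>y. y \<in> K \<Longrightarrow> (\<Sum>i\<in>F. a i * (f i y - t i)) \<ge> \<delta>"
proof -
  define q where "q y = (\<Sum>i\<in>F. (f i y - t i)\<^sup>2)" for y
  define \<delta> where "\<delta> = Inf (q ` K)"
  have q_ge: "q y \<ge> e\<^sup>2" if y: "y \<in> K" for y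
  proof -
    obtain i where i: "i \<in> F" "\<bar>f i y - t i\<bar> \<ge> e" using away[OF y] by blast
    have "e\<^sup>2 \<le> (f i y - t i)\<^sup>2"
      using i(2) \<open>e > 0\<close> by (metis abs_le_square_iff abs_of_pos)
    also have "\<dots> \<le> q y" unfolding q_def
      using F i(1) by (intro member_le_sum) auto
    finally show ?thesis .
  qed
  have bdd: "bdd_below (q ` K)" using q_ge by (intro bdd_belowI[of _ "e\<^sup>2"]) auto
  have "\<delta> \<ge> e\<^sup>2" unfolding \<delta>_def using K q_ge by (intro cInf_greatest) auto
  then have "\<delta> > 0" using \<open>e > 0\<close> by (smt (verit) zero_less_power)
  have q_lower: "\<delta> \<le> q y" if "y \<in> K" for y
    unfolding \<delta>_def using bdd that by (intro cInf_lower) auto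
  have "\<exists>y\<in>K. q y < \<delta> + 1 / real (Suc n)" for n
    using cInf_lessD[of "q ` K" "\<delta> + 1 / real (Suc n)"] K by (auto simp: \<delta>_def)
  then obtain y where y: "\<And>n. y n \<in> K" and y_lim: "\<And>n. q (y n) < \<delta> + 1 / real (Suc n)"
    by metis
  have lin_comb: "f i (u *\<^sub>R x + v *\<^sub>R w) = u * f i x + v * f i w" if "i \<in> F" for i u v x w
    using lin[OF that] by (simp add: linear_add linear_cmul)
  have para: "(\<Sum>i\<in>F. (f i x - f i w)\<^sup>2) \<le> 2 * (q x - \<delta>) + 2 * (q w - \<delta>)"
    if "x \<in> K" "w \<in> K" for x w
  proof -
    define m where "m = (1/2) *\<^sub>R x + (1/2) *\<^sub>R w"
    define N where "N = (\<Sum>i\<in>F. (f i x - f i w)\<^sup>2)"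
    have "m \<in> K" unfolding m_def using K that by (intro convexD) auto
    then have "\<delta> \<le> q m" using q_lower by simp
    moreover have "N + 4 * q m = 2 * q x + 2 * q w"
      unfolding N_def q_def sum_distrib_left sum.distrib[symmetric]
      by (intro sum.cong) (auto simp: m_def lin_comb power2_eq_square algebra_simps)
    ultimately have "N \<le> 2 * (q x - \<delta>) + 2 * (q w - \<delta>)" by (simp add: algebra_simps)
    then show ?thesis by (simp only: N_def)
  qed
  have "Cauchy (\<lambda>n. f i (y n))" if i: "i \<in> F" for i
  proof (rule CauchyI)
    fix \<epsilon> :: real assume "\<epsilon> > 0"
    then obtain M where M: "4 / \<epsilon>\<^sup>2 < real M"
      using reals_Archimedean2 by blast
    have "norm (f i (y m) - f i (y n)) < \<epsilon>" if mn: "m \<ge> M" "n \<ge> M" for m n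
    proof -
      have small: "q (y k) - \<delta> < \<epsilon>\<^sup>2 / 4" if "k \<ge> M" for k
      proof -
        have "4 / \<epsilon>\<^sup>2 < real (Suc k)" using M that by simp
        then have "1 / real (Suc k) < \<epsilon>\<^sup>2 / 4"
          using \<open>\<epsilon> > 0\<close> by (simp add: field_simps)
        then show ?thesis using y_lim[of k] by linarith
      qed
      have "(f i (y m) - f i (y n))\<^sup>2 \<le> (\<Sum>i\<in>F. (f i (y m) - f i (y n))\<^sup>2)"
        using F i by (intro member_le_sum) auto
      also have "\<dots> \<le> 2 * (q (y m) - \<delta>) + 2 * (q (y n) - \<delta>)" using para y by blast
      also have "\<dots> < \<epsilon>\<^sup>2" using small[OF mn(1)] small[OF mn(2)] by (simp add: field_simps)
      finally show ?thesis
        using \<open>\<epsilon> > 0\<close> by (metis abs_le_square_iff abs_of_pos not_le real_norm_def)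
    qed
    then show "\<exists>M. \<forall>m\<ge>M. \<forall>n\<ge>M. norm (f i (y m) - f i (y n)) < \<epsilon>" by blast
  qed
  then have "\<forall>i\<in>F. \<exists>l. (\<lambda>n. f i (y n)) \<longlonglongrightarrow> l"
    using Cauchy_convergent convergent_def by blast
  then obtain l where l: "\<And>i. i \<in> F \<Longrightarrow> (\<lambda>n. f i (y n)) \<longlonglongrightarrow> l i"
    by metis
  define a where "a i = l i - t i" for i
  have sum_a: "(\<Sum>i\<in>F. (a i)\<^sup>2) = \<delta>"
  proof (rule LIMSEQ_unique)
    show "(\<lambda>n. q (y n)) \<longlonglongrightarrow> (\<Sum>i\<in>F. (a i)\<^sup>2)"
      unfolding q_def a_def by (intro tendsto_intros l)
    have "(\<lambda>n. \<delta> + 1 / real (Suc n)) \<longlonglongrightarrow> \<delta> + 0"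
      by (rule tendsto_add[OF tendsto_const LIMSEQ_Suc[OF lim_const_over_n]])
    then have "(\<lambda>n. \<delta> + 1 / real (Suc n)) \<longlonglongrightarrow> \<delta>" by simp
    then show "(\<lambda>n. q (y n)) \<longlonglongrightarrow> \<delta>"
      using tendsto_sandwich[of "\<lambda>_. \<delta>" "\<lambda>n. q (y n)" sequentially "\<lambda>n. \<delta> + 1 / real (Suc n)" \<delta>]
        q_lower[OF y] y_lim[THEN less_imp_le] by simp
  qed
  show ?thesis
  proof (rule that[of \<delta> a])
    show "\<delta> > 0" by fact
    fix x assume x: "x \<in> K"
    define g where "g i = f i x - t i" for i
    define P where "P = (\<Sum>i\<in>F. a i * g i)"
    (* First-order condition: moving from the nearest point towards x does not decrease the distance. *)
    have step: "2 * (1 - s) * P + s * q x \<ge> (2 - s) * \<delta>" if s: "0 < s" "s < 1" for s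
    proof -
      have "\<delta> \<le> q ((1 - s) *\<^sub>R y n + s *\<^sub>R x)" for n
        using K y x s by (intro q_lower convexD) auto
      then have "\<delta> \<le> (\<Sum>i\<in>F. ((1 - s) * f i (y n) + s * f i x - t i)\<^sup>2)" for n
        unfolding q_def by (simp add: lin_comb)
      moreover have "(\<lambda>n. \<Sum>i\<in>F. ((1 - s) * f i (y n) + s * f i x - t i)\<^sup>2)
          \<longlonglongrightarrow> (\<Sum>i\<in>F. ((1 - s) * l i + s * f i x - t i)\<^sup>2)"
        by (intro tendsto_intros l)
      ultimately have "\<delta> \<le> (\<Sum>i\<in>F. ((1 - s) * l i + s * f i x - t i)\<^sup>2)"
        by (intro LIMSEQ_le_const) auto
      also have "\<dots> = (\<Sum>i\<in>F. (1 - s)\<^sup>2 * (a i)\<^sup>2 + 2 * s * (1 - s) * (a i * g i) + s\<^sup>2 * (g i)\<^sup>2)"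
        unfolding a_def g_def
        by (intro sum.cong) (auto simp: power2_eq_square algebra_simps)
      also have "\<dots> = (1 - s)\<^sup>2 * \<delta> + 2 * s * (1 - s) * P + s\<^sup>2 * q x"
        by (simp add: sum.distrib sum_distrib_left[symmetric] sum_a P_def q_def g_def)
      finally have "s * ((2 - s) * \<delta>) \<le> s * (2 * (1 - s) * P + s * q x)"
        by (simp add: power2_eq_square algebra_simps)
      then show ?thesis using s by simp
    qed
    have "2 * \<delta> \<le> 2 * P"
    proof (rule tendsto_le[of "at_right (0::real)"])
      show "((\<lambda>s. 2 * (1 - s) * P + s * q x) \<longlongrightarrow> 2 * P) (at_right 0)"
        by (auto intro!: tendsto_eq_intros)
      show "((\<lambda>s. (2 - s) * \<delta>) \<longlongrightarrow> 2 * \<delta>) (at_right 0)"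
        by (auto intro!: tendsto_eq_intros)
      show "\<forall>\<^sub>F s in at_right 0. (2 - s) * \<delta> \<le> 2 * (1 - s) * P + s * q x"
        using step by (auto simp: eventually_at_right_field intro!: exI[of _ 1])
    qed simp
    then show "(\<Sum>i\<in>F. a i * (f i x - t i)) \<ge> \<delta>"
      by (simp add: P_def g_def)
  qed
qed

section \<open>The weak topology\<close>

lemma openin_weak_topology_subbasic:
  assumes "open U"
  shows "openin (weak_topology p) {y. p y z \<in> U}"
proof -
  have "(\<lambda>y. p y z) -` U \<in> {(\<lambda>y. p y z) -` U | z U. open U}" using assms by blast
  then show ?thesis
    unfolding weak_topology_def by (simp add: vimage_def topology_generated_by_Basis)
qed

lemma weak_topology_basic_nbhd:
  fixes p :: "'y \<Rightarrow> 'z \<Rightarrow> real"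
  assumes "openin (weak_topology p) U" and "x \<in> U"
  obtains F e where "finite F" "e > 0" "\<And>y. (\<And>z. z \<in> F \<Longrightarrow> \<bar>p y z - p x z\<bar> < e) \<Longrightarrow> y \<in> U"
proof -
  have "generate_topology_on {(\<lambda>y. p y z) -` U | z U. open U} U"
    using assms(1) unfolding weak_topology_def openin_topology_generated_by_iff .
  then have "x \<in> U \<longrightarrow> (\<exists>F e. finite F \<and> e > 0 \<and> (\<forall>y. (\<forall>z\<in>F. \<bar>p y z - p x z\<bar> < e) \<longrightarrow> y \<in> U))"
  proof induction
    case Empty
    then show ?case by simp
  next
    case (Int A B)
    show ?case
    proof
      assume "x \<in> A \<inter> B"
      then obtain F e F' e' where
        "finite F" "e > 0" "\<forall>y. (\<forall>z\<in>F. \<bar>p y z - p x z\<bar> < e) \<longrightarrow> y \<in> A"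
        "finite F'" "e' > 0" "\<forall>y. (\<forall>z\<in>F'. \<bar>p y z - p x z\<bar> < e') \<longrightarrow> y \<in> B"
        using Int by blast
      then show "\<exists>F e. finite F \<and> e > 0 \<and> (\<forall>y. (\<forall>z\<in>F. \<bar>p y z - p x z\<bar> < e) \<longrightarrow> y \<in> A \<inter> B)"
        by (intro exI[of _ "F \<union> F'"] exI[of _ "min e e'"]) auto
    qed
  next
    case (UN \<U>)
    then show ?case by (meson Union_iff)
  next
    case (Basis A)
    then obtain z V where A: "A = (\<lambda>y. p y z) -` V" "open V" by blast
    show ?case
    proof
      assume "x \<in> A"
      then obtain e where "e > 0" "\<And>r. \<bar>r - p x z\<bar> < e \<Longrightarrow> r \<in> V"
        using A open_real by (metis open_dist dist_real_def vimageD)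
      then show "\<exists>F e. finite F \<and> e > 0 \<and> (\<forall>y. (\<forall>z\<in>F. \<bar>p y z - p x z\<bar> < e) \<longrightarrow> y \<in> A)"
        using A by (intro exI[of _ "{z}"] exI[of _ e]) auto
    qed
  qed
  with assms(2) obtain F e where
    "finite F" "e > 0" "\<forall>y. (\<forall>z\<in>F. \<bar>p y z - p x z\<bar> < e) \<longrightarrow> y \<in> U"
    by blast
  then show ?thesis by (intro that[of F e]) auto
qed

lemma limitin_weak_topology_iff:
  "limitin (weak_topology p) s x A \<longleftrightarrow> (\<forall>z. ((\<lambda>n. p (s n) z) \<longlongrightarrow> p x z) A)"
proof
  assume lim: "limitin (weak_topology p) s x A"
  show "\<forall>z. ((\<lambda>n. p (s n) z) \<longlongrightarrow> p x z) A"
  proof (intro allI topological_tendstoI)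
    fix z U assume "open U" "p x z \<in> U"
    then show "\<forall>\<^sub>F n in A. p (s n) z \<in> U"
      using lim openin_weak_topology_subbasic[of U p z] unfolding limitin_def by force
  qed
next
  assume lim: "\<forall>z. ((\<lambda>n. p (s n) z) \<longlongrightarrow> p x z) A"
  show "limitin (weak_topology p) s x A"
    unfolding limitin_def
  proof (intro conjI allI impI)
    fix U assume "openin (weak_topology p) U \<and> x \<in> U"
    then obtain F e where Fe: "finite F" "e > 0"
        "\<And>y. (\<And>z. z \<in> F \<Longrightarrow> \<bar>p y z - p x z\<bar> < e) \<Longrightarrow> y \<in> U"
      using weak_topology_basic_nbhd by metis
    have "\<forall>\<^sub>F n in A. \<forall>z\<in>F. \<bar>p (s n) z - p x z\<bar> < e"
      using lim Fe by (intro eventually_ball_finite) (auto simp: tendsto_iff dist_real_def)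
    then show "\<forall>\<^sub>F n in A. s n \<in> U"
      by eventually_elim (use Fe in blast)
  qed simp
qed

section \<open>Polars\<close>

lemma one_sided_polar_antimono: "A \<subseteq> B \<Longrightarrow> one_sided_polar p B \<subseteq> one_sided_polar p A"
  by (auto simp: one_sided_polar_def)

lemma subset_bipolar: "A \<subseteq> one_sided_polar (\<lambda>z y. p y z) (one_sided_polar p A)"
  by (auto simp: one_sided_polar_def)

lemma bilinear_flip: "bilinear p \<Longrightarrow> bilinear (\<lambda>z y. p y z)"
  by (simp add: bilinear_def)

lemma zero_in_one_sided_polar: "bilinear p \<Longrightarrow> 0 \<in> one_sided_polar p A"
  by (simp add: one_sided_polar_def bilinear_rzero)

lemma convex_one_sided_polar:
  assumes "bilinear p"
  shows "convex (one_sided_polar p A)"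
proof (rule convexI)
  fix x y and u v :: real
  assume *: "x \<in> one_sided_polar p A" "y \<in> one_sided_polar p A" "0 \<le> u" "0 \<le> v" "u + v = 1"
  have "u * p a x + v * p a y \<le> 1" if "a \<in> A" for a
    using * that by (intro convex_bound_le) (auto simp: one_sided_polar_def)
  then show "u *\<^sub>R x + v *\<^sub>R y \<in> one_sided_polar p A"
    by (simp add: one_sided_polar_def bilinear_radd[OF assms] bilinear_rmul[OF assms])
qed

text \<open>Dilating an element of a cone by arbitrarily large factors leaves no room for a positive value.\<close>

lemma one_sided_polar_cone:
  assumes p: "bilinear p" and C: "convex_cone C"
  shows "one_sided_polar p C = {z. \<forall>c\<in>C. p c z \<le> 0}"
proof -
  have "p c z \<le> 0" if z: "\<forall>c\<in>C. p c z \<le> 1" and c: "c \<in> C" for c z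
  proof (rule ccontr)
    assume "\<not> p c z \<le> 0"
    moreover from this have "(2 / p c z) *\<^sub>R c \<in> C"
      using C c by (intro convex_cone_scaleR) auto
    then have "p ((2 / p c z) *\<^sub>R c) z \<le> 1" using z by blast
    ultimately show False by (simp add: bilinear_lmul[OF p])
  qed
  then have "(\<forall>c\<in>C. p c z \<le> 1) \<longleftrightarrow> (\<forall>c\<in>C. p c z \<le> 0)" for z
    by (meson order_trans zero_le_one)
  then show ?thesis by (simp add: one_sided_polar_def)
qed

lemma convex_cone_one_sided_polar:
  assumes "bilinear p" and "convex_cone C"
  shows "convex_cone (one_sided_polar p C)"
proof -
  have add: "p c x + p c y \<le> 0" if "p c x \<le> 0" "p c y \<le> 0" for c x y
    using that by (rule add_nonpos_nonpos)
  have scale: "l * p c x \<le> 0" if "p c x \<le> 0" "l \<ge> 0" for c x and l :: real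
    using that by (simp add: mult_nonneg_nonpos)
  show ?thesis
    unfolding convex_cone_iff one_sided_polar_cone[OF assms]
    by (simp add: bilinear_rzero[OF assms(1)] bilinear_radd[OF assms(1)] bilinear_rmul[OF assms(1)]
        add scale)
qed

text \<open>Both summands lie in the sum as \<open>0 \<in> B\<close> and \<open>0 \<in> C\<close>; conversely the cone contributes at most
  \<open>0\<close> to the pairing, so the bound \<open>1\<close> from \<open>B\<close> survives.\<close>

lemma one_sided_polar_add_cone:
  assumes p: "bilinear p" and B: "0 \<in> B" and C: "convex_cone C"
  shows "one_sided_polar p (B + C) = one_sided_polar p B \<inter> one_sided_polar p C"
proof
  have "0 \<in> C" using C convex_cone_contains_0 by blast
  have "B \<subseteq> B + C" using set_plus_intro[OF _ \<open>0 \<in> C\<close>, of _ B] by auto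
  moreover have "C \<subseteq> B + C" using set_plus_intro[OF B, of _ C] by auto
  ultimately show "one_sided_polar p (B + C) \<subseteq> one_sided_polar p B \<inter> one_sided_polar p C"
    by (simp add: one_sided_polar_antimono)
  show "one_sided_polar p B \<inter> one_sided_polar p C \<subseteq> one_sided_polar p (B + C)"
  proof
    fix z assume z: "z \<in> one_sided_polar p B \<inter> one_sided_polar p C"
    have "p b z + p c z \<le> 1" if "b \<in> B" "c \<in> C" for b c
    proof -
      have "p b z \<le> 1" using z that by (auto simp: one_sided_polar_def)
      moreover have "p c z \<le> 0" using z that one_sided_polar_cone[OF p C] by blast
      ultimately show ?thesis by linarith
    qed
    then show "z \<in> one_sided_polar p (B + C)"
      by (auto simp: one_sided_polar_def bilinear_ladd[OF p] elim!: set_plus_elim)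
  qed
qed

text \<open>A point outside \<open>K\<close> is told apart from \<open>K\<close> by finitely many \<open>p _ z\<close>, so the separating functional
  is a linear combination of these and by bilinearity again some \<open>p _ w\<close>. Since \<open>0 \<in> K\<close>, this
  functional is positive at the point and can be rescaled to put \<open>w\<close> in the polar.\<close>

lemma bipolar_eq:
  fixes p :: "'y::real_vector \<Rightarrow> 'z::real_vector \<Rightarrow> real"
  assumes p: "bilinear p" and K: "convex K" "0 \<in> K" and closed: "closedin (weak_topology p) K"
  shows "one_sided_polar (\<lambda>z y. p y z) (one_sided_polar p K) = K"
proof
  show "K \<subseteq> one_sided_polar (\<lambda>z y. p y z) (one_sided_polar p K)" by (rule subset_bipolar)
  show "one_sided_polar (\<lambda>z y. p y z) (one_sided_polar p K) \<subseteq> K"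
  proof
    fix x assume x: "x \<in> one_sided_polar (\<lambda>z y. p y z) (one_sided_polar p K)"
    show "x \<in> K"
    proof (rule ccontr)
      assume "x \<notin> K"
      moreover have "openin (weak_topology p) (- K)"
        using closed by (simp add: closedin_def Compl_eq_Diff_UNIV)
      ultimately obtain F e where F: "finite F" "e > 0"
          "\<And>y. (\<And>z. z \<in> F \<Longrightarrow> \<bar>p y z - p x z\<bar> < e) \<Longrightarrow> y \<in> - K"
        using weak_topology_basic_nbhd[of p "- K" x] by (metis ComplI)
      obtain a \<delta> where \<delta>: "\<delta> > 0" and a: "\<And>y. y \<in> K \<Longrightarrow> (\<Sum>z\<in>F. a z * (p y z - p x z)) \<ge> \<delta>"
      proof (rule finite_family_separation[of F "\<lambda>z y. p y z" K e "p x"])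
        show "linear (\<lambda>y. p y z)" for z using p by (simp add: bilinear_def)
        show "\<exists>z\<in>F. \<bar>p y z - p x z\<bar> \<ge> e" if "y \<in> K" for y
          using F(3)[of y] that by force
      qed (use F K in auto)
      define w where "w = - (\<Sum>z\<in>F. a z *\<^sub>R z)"
      have pw: "p y w = - (\<Sum>z\<in>F. a z * p y z)" for y
      proof -
        have "linear (p y)" using p by (simp add: bilinear_def)
        then show ?thesis
          by (simp add: w_def linear_neg linear_sum linear_cmul)
      qed
      have sep: "p y w \<le> p x w - \<delta>" if "y \<in> K" for y
        using a[OF that] by (simp add: pw right_diff_distrib sum_subtractf)
      (* Dividing w by any number between the supremum of p _ w on K and p x w separates at level 1. *)
      define m where "m = p x w - \<delta> / 2"
      have "m > 0"
        using sep[OF K(2)] \<delta> by (simp add: m_def bilinear_lzero[OF p])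
      have "(1 / m) *\<^sub>R w \<in> one_sided_polar p K"
        using sep \<delta> \<open>m > 0\<close>
        by (force simp: one_sided_polar_def bilinear_rmul[OF p] m_def)
      then have "p x ((1 / m) *\<^sub>R w) \<le> 1"
        using x unfolding one_sided_polar_def[of "\<lambda>z y. p y z"] by simp
      then have "p x w / m \<le> 1" by (simp add: bilinear_rmul[OF p])
      then show False using \<open>m > 0\<close> \<delta> by (simp add: m_def field_simps)
    qed
  qed
qed

section \<open>The two dualities\<close>

lemma scaled_add_cone:
  fixes B C :: "'v::real_vector set"
  assumes C: "convex_cone C" and "l > 0"
  shows "(*\<^sub>R) l ` B + C = (*\<^sub>R) l ` (B + C)"
proof
  show "(*\<^sub>R) l ` B + C \<subseteq> (*\<^sub>R) l ` (B + C)"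
  proof
    fix x assume "x \<in> (*\<^sub>R) l ` B + C"
    then obtain b c where x: "x = l *\<^sub>R b + c" "b \<in> B" "c \<in> C" by (auto elim!: set_plus_elim)
    have "(1 / l) *\<^sub>R c \<in> C" using C x \<open>l > 0\<close> by (intro convex_cone_scaleR) auto
    moreover have "x = l *\<^sub>R (b + (1 / l) *\<^sub>R c)" using x \<open>l > 0\<close> by (simp add: scaleR_add_right)
    ultimately show "x \<in> (*\<^sub>R) l ` (B + C)" using x by (blast intro: set_plus_intro)
  qed
  have "l *\<^sub>R c \<in> C" if "c \<in> C" for c
    using C \<open>l > 0\<close> that by (intro convex_cone_scaleR) auto
  then show "(*\<^sub>R) l ` (B + C) \<subseteq> (*\<^sub>R) l ` B + C"
    by (auto elim!: set_plus_elim simp: scaleR_add_right intro!: set_plus_intro imageI)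
qed

lemma subset_dilate:
  fixes B :: "'v::real_vector set"
  assumes "convex B" "0 \<in> B" "l > 1"
  shows "B \<subseteq> (*\<^sub>R) l ` B"
proof
  fix b assume "b \<in> B"
  then have "(1 / l) *\<^sub>R b \<in> B"
    using convexD[OF assms(1), of b 0 "1 / l" "1 - 1 / l"] assms by auto
  moreover have "b = l *\<^sub>R ((1 / l) *\<^sub>R b)" using assms by simp
  ultimately show "b \<in> (*\<^sub>R) l ` B" by blast
qed

lemma coadditive_wrt_dilate:
  assumes "coadditive_wrt C D B1 B2" "convex B2" "0 \<in> B2" "l > 1"
  shows "coadditive_wrt C D B1 ((*\<^sub>R) l ` B2)"
  using assms(1) set_plus_mono2[OF subset_dilate[OF assms(2-4)] order_refl, of C]
  unfolding coadditive_wrt_def by blast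

text \<open>The polar of \<open>(B2 \<inter> C) + D\<close> contains \<open>(B2\<^sup>\<odot> + C\<^sup>\<odot>) \<inter> D\<^sup>\<odot>\<close>, hence \<open>B1\<^sup>\<odot>\<close> by
  coadditivity; now pass to polars once more.\<close>

lemma additive_if_polar_coadditive:
  assumes p: "bilinear p" and C: "convex_cone C" and D: "convex_cone D"
    and B1: "convex B1" "0 \<in> B1" "closedin (weak_topology p) B1" and B2: "0 \<in> B2"
    and coadd: "coadditive_wrt (one_sided_polar p C) (one_sided_polar p D)
      (one_sided_polar p B1) (one_sided_polar p B2)"
  shows "additive_wrt C D B1 B2"
proof -
  have "0 \<in> C" using C convex_cone_contains_0 by blast
  have "one_sided_polar p B2 + one_sided_polar p C \<subseteq> one_sided_polar p (B2 \<inter> C)"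
  proof
    fix z assume "z \<in> one_sided_polar p B2 + one_sided_polar p C"
    then obtain u v where z: "z = u + v" "u \<in> one_sided_polar p B2" "v \<in> one_sided_polar p C"
      by (rule set_plus_elim)
    have "p b z \<le> 1" if "b \<in> B2 \<inter> C" for b
    proof -
      have "p b u \<le> 1" using z that by (auto simp: one_sided_polar_def)
      moreover have "p b v \<le> 0" using z that one_sided_polar_cone[OF p C] by blast
      ultimately show ?thesis by (simp add: z(1) bilinear_radd[OF p])
    qed
    then show "z \<in> one_sided_polar p (B2 \<inter> C)" by (simp add: one_sided_polar_def)
  qed
  then have "one_sided_polar p B1 \<subseteq> one_sided_polar p ((B2 \<inter> C) + D)"
    using coadd one_sided_polar_add_cone[OF p _ D, of "B2 \<inter> C"] B2 \<open>0 \<in> C\<close>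
    unfolding coadditive_wrt_def by blast
  then have "(B2 \<inter> C) + D \<subseteq> one_sided_polar (\<lambda>z y. p y z) (one_sided_polar p B1)"
    by (rule order_trans[OF subset_bipolar one_sided_polar_antimono])
  then show ?thesis
    using bipolar_eq[OF p B1] by (simp add: additive_wrt_def)
qed

text \<open>A closed sum \<open>B2\<^sup>\<odot> + C\<^sup>\<odot>\<close> is its own bipolar, hence the polar of \<open>B2 \<inter> C\<close>.\<close>

lemma polar_coadditive_if_additive:
  assumes p: "bilinear p"
    and C: "convex_cone C" "closedin (weak_topology p) C" and D: "convex_cone D"
    and B2: "convex B2" "0 \<in> B2" "closedin (weak_topology p) B2"
    and closed: "closedin (weak_topology (\<lambda>z y. p y z)) (one_sided_polar p B2 + one_sided_polar p C)"
    and add: "additive_wrt C D B1 B2"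
  shows "coadditive_wrt (one_sided_polar p C) (one_sided_polar p D)
      (one_sided_polar p B1) (one_sided_polar p B2)"
proof -
  let ?S = "one_sided_polar p B2 + one_sided_polar p C"
  note p' = bilinear_flip[OF p]
  have C0: "convex C" "0 \<in> C"
    using C(1) by (simp_all add: convex_cone_def convex_cone_contains_0)
  have "convex ?S"
    by (intro convex_set_plus convex_one_sided_polar p)
  moreover have "0 \<in> ?S"
    using set_plus_intro[OF zero_in_one_sided_polar[OF p] zero_in_one_sided_polar[OF p]] by simp
  ultimately have "?S = one_sided_polar p (one_sided_polar (\<lambda>z y. p y z) ?S)"
    using bipolar_eq[OF p' _ _ closed] by simp
  also have "\<dots> = one_sided_polar p (B2 \<inter> C)"
    using one_sided_polar_add_cone[OF p' zero_in_one_sided_polar[OF p]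
        convex_cone_one_sided_polar[OF p C(1)], of B2]
      bipolar_eq[OF p B2] bipolar_eq[OF p C0 C(2)] by simp
  finally have "?S \<inter> one_sided_polar p D = one_sided_polar p ((B2 \<inter> C) + D)"
    using one_sided_polar_add_cone[OF p _ D, of "B2 \<inter> C"] B2 C0 by simp
  then show ?thesis
    using one_sided_polar_antimono[OF add[unfolded additive_wrt_def], of p]
    by (simp add: coadditive_wrt_def)
qed

text \<open>Each \<open>l > 1\<close> bounds the pairing on \<open>B1\<close> by \<open>l\<close>; let \<open>l\<close> tend to \<open>1\<close>.\<close>

lemma polar_additive_if_dilated_coadditive:
  assumes p: "bilinear p" and C: "convex_cone C" and D: "convex_cone D"
    and coadd: "\<And>l::real. l > 1 \<Longrightarrow> coadditive_wrt C D B1 ((*\<^sub>R) l ` B2)"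
  shows "additive_wrt (one_sided_polar p C) (one_sided_polar p D)
      (one_sided_polar p B1) (one_sided_polar p B2)"
proof -
  have "p b (u + v) \<le> 1"
    if u: "u \<in> one_sided_polar p B2 \<inter> one_sided_polar p C" and v: "v \<in> one_sided_polar p D"
      and b: "b \<in> B1" for u v b
  proof (rule field_le_epsilon)
    fix e :: real assume "e > 0"
    then have "b \<in> ((*\<^sub>R) (1 + e) ` B2 + C) \<inter> D"
      using coadd[of "1 + e"] b by (auto simp: coadditive_wrt_def)
    then obtain b' c where b': "b = (1 + e) *\<^sub>R b' + c" "b' \<in> B2" "c \<in> C" "b \<in> D"
      by (auto elim!: set_plus_elim)
    have "p b v \<le> 0" using v b'(4) one_sided_polar_cone[OF p D] by blast
    moreover have "p c u \<le> 0" using u b'(3) one_sided_polar_cone[OF p C] by blast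
    moreover have "(1 + e) * p b' u \<le> 1 + e"
      using u b'(2) \<open>e > 0\<close> by (auto simp: one_sided_polar_def)
    moreover have "p b (u + v) = (1 + e) * p b' u + p c u + p b v"
      by (simp only: bilinear_radd[OF p], simp add: b'(1) bilinear_ladd[OF p] bilinear_lmul[OF p])
    ultimately show "p b (u + v) \<le> 1 + e" by linarith
  qed
  then show ?thesis
    unfolding additive_wrt_def one_sided_polar_def[of p B1] by (auto elim!: set_plus_elim)
qed

text \<open>Coadditivity with \<open>B2 + C\<close> replaced by its bipolar, that is, by its weakly closed
  convex hull. When \<open>B2 + C\<close> is convex and closed this is coadditivity; when it is only cs-closed
  this still gives \<open>B1 \<subseteq> D\<close>.\<close>

lemma bipolar_coadditive_if_polar_additive:
  assumes p: "bilinear p" and C: "convex_cone C"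
    and D: "convex_cone D" "closedin (weak_topology p) D" and B2: "0 \<in> B2"
    and add: "additive_wrt (one_sided_polar p C) (one_sided_polar p D)
      (one_sided_polar p B1) (one_sided_polar p B2)"
  shows "B1 \<subseteq> one_sided_polar (\<lambda>z y. p y z) (one_sided_polar p (B2 + C)) \<inter> D"
proof -
  let ?q = "\<lambda>z y. p y z"
  let ?P = "one_sided_polar p B2 \<inter> one_sided_polar p C"
  have D0: "convex D" "0 \<in> D"
    using D(1) by (simp_all add: convex_cone_def convex_cone_contains_0)
  have "B1 \<subseteq> one_sided_polar ?q (one_sided_polar p B1)" by (rule subset_bipolar)
  also have "\<dots> \<subseteq> one_sided_polar ?q (?P + one_sided_polar p D)"
    using add unfolding additive_wrt_def by (rule one_sided_polar_antimono)
  also have "\<dots> = one_sided_polar ?q ?P \<inter> one_sided_polar ?q (one_sided_polar p D)"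
    by (rule one_sided_polar_add_cone[OF bilinear_flip[OF p] _ convex_cone_one_sided_polar[OF p D(1)]])
      (simp add: zero_in_one_sided_polar[OF p])
  finally show ?thesis
    using one_sided_polar_add_cone[OF p B2 C] bipolar_eq[OF p D0 D(2)] by simp
qed

section \<open>Absorption by cs-closed sets\<close>

text \<open>Iterating \<open>approx\<close> from \<open>x 0 = b\<close> with a fixed ratio \<open>r\<close> gives \<open>x n = s n + r x (n+1)\<close> with \<open>s n \<in> S\<close>
  and \<open>x (n+1) \<in> G\<close>, so \<open>b\<close> is the sum of the \<open>r\<^sup>n s n\<close> up to the remainder \<open>r\<^sup>n x n\<close>. The remainders
  are, up to a factor, terms of a series that converges by pre-cs-compactness, hence tend to zero.
  Normalising the weights to \<open>(1 - r) r\<^sup>n\<close> puts \<open>(1 - r) b\<close> into \<open>S\<close>.\<close>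

lemma cs_closed_absorbs_dilate:
  fixes p :: "'y::real_vector \<Rightarrow> 'z::real_vector \<Rightarrow> real"
  assumes p: "bilinear p" and S: "cs_closed (weak_topology p) S"
    and G: "G \<subseteq> B" "pre_cs_compact (weak_topology p) G"
    and approx: "\<And>b r. b \<in> B \<Longrightarrow> r > 0 \<Longrightarrow> \<exists>g\<in>G. b - r *\<^sub>R g \<in> S"
    and l: "l > (1::real)"
  shows "B \<subseteq> (*\<^sub>R) l ` S"
proof
  fix b assume b: "b \<in> B"
  (* Chosen so that the geometric series with ratio r has sum l. *)
  define r where "r = 1 - 1 / l"
  have r: "0 < r" "r < 1" "1 - r = 1 / l" using l by (auto simp: r_def)
  have "\<forall>b\<in>B. \<exists>g. g \<in> G \<and> b - r *\<^sub>R g \<in> S"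
    using approx r(1) by blast
  then obtain h where h: "\<And>b. b \<in> B \<Longrightarrow> h b \<in> G \<and> b - r *\<^sub>R h b \<in> S"
    by (rule bchoice[THEN exE]) blast
  define x where "x n = (h ^^ n) b" for n
  define s where "s n = x n - r *\<^sub>R x (Suc n)" for n
  define c where "c n = (1 - r) * r ^ n" for n
  have xB: "x n \<in> B" for n
    by (induction n) (use b h G(1) in \<open>auto simp: x_def\<close>)
  have xG: "x (Suc n) \<in> G" and sS: "s n \<in> S" for n
    using h[OF xB[of n]] by (auto simp: s_def x_def)
  have c_nonneg: "0 \<le> c n" for n using r(1,2) by (simp add: c_def)
  have c_sums: "c sums 1"
    using sums_mult[OF geometric_sums[of r], of "1 - r"] r(1,2) by (simp add: c_def[abs_def])
  have telescope: "(\<Sum>n<N. c n *\<^sub>R s n) = (1 - r) *\<^sub>R b - c N *\<^sub>R x N" for N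
    by (induction N) (auto simp: c_def s_def x_def algebra_simps)
  obtain t where "limitin (weak_topology p) (\<lambda>N. \<Sum>n<N. c n *\<^sub>R x (Suc n)) t sequentially"
    using G(2)[unfolded pre_cs_compact_def, rule_format, of "\<lambda>n. x (Suc n)" c] xG c_nonneg c_sums
    by auto
  then have lim: "(\<lambda>N. p (\<Sum>n<N. c n *\<^sub>R x (Suc n)) z) \<longlonglongrightarrow> p t z" for z
    by (simp add: limitin_weak_topology_iff)
  have rest: "(\<lambda>N. p (c N *\<^sub>R x N) z) \<longlonglongrightarrow> 0" for z
  proof -
    have lin: "linear (\<lambda>y. p y z)" using p by (simp add: bilinear_def)
    have "(\<lambda>n. p (c n *\<^sub>R x (Suc n)) z) sums p t z"
      using lim[of z] by (simp add: sums_def linear_sum[OF lin])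
    then have "(\<lambda>n. p (c n *\<^sub>R x (Suc n)) z) \<longlonglongrightarrow> 0"
      using sums_summable summable_LIMSEQ_zero by blast
    then have "(\<lambda>n. r * p (c n *\<^sub>R x (Suc n)) z) \<longlonglongrightarrow> 0"
      using tendsto_mult_right_zero by blast
    moreover have "r * p (c n *\<^sub>R x (Suc n)) z = p (c (Suc n) *\<^sub>R x (Suc n)) z" for n
      by (simp add: bilinear_lmul[OF p] c_def)
    ultimately show ?thesis using LIMSEQ_imp_Suc by auto
  qed
  have "limitin (weak_topology p) (\<lambda>N. \<Sum>n<N. c n *\<^sub>R s n) ((1 - r) *\<^sub>R b) sequentially"
    unfolding limitin_weak_topology_iff telescope bilinear_lsub[OF p]
    using tendsto_diff[OF tendsto_const rest] by fastforce
  then have "(1 - r) *\<^sub>R b \<in> S"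
    using S[unfolded cs_closed_def, rule_format, of s c] sS c_nonneg c_sums by blast
  moreover have "b = l *\<^sub>R ((1 - r) *\<^sub>R b)" using l r by simp
  ultimately show "b \<in> (*\<^sub>R) l ` S" by blast
qed

section \<open>Duality of additivity and coadditivity\<close>

theorem theorem3p5:
  fixes p :: "'y::real_vector \<Rightarrow> 'z::real_vector \<Rightarrow> real"
    and C D B1 B2 :: "'y set"
  assumes "dual_pair p"
    and "convex_cone C" and "closedin (weak_topology p) C"
    and "convex_cone D" and "closedin (weak_topology p) D"
    and "convex B1" and "0 \<in> B1" and "closedin (weak_topology p) B1"
    and "convex B2" and "0 \<in> B2" and "closedin (weak_topology p) B2"
  shows
   "(coadditive_wrt (one_sided_polar p C) (one_sided_polar p D)
        (one_sided_polar p B1) (one_sided_polar p B2)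
      \<longrightarrow> additive_wrt C D B1 B2) \<and>
     (closedin (weak_topology (\<lambda>z y. p y z)) (one_sided_polar p B2 + one_sided_polar p C)
      \<longrightarrow> (additive_wrt C D B1 B2 \<longleftrightarrow>
           coadditive_wrt (one_sided_polar p C) (one_sided_polar p D)
             (one_sided_polar p B1) (one_sided_polar p B2))) \<and>
     ((\<forall>l::real>1. coadditive_wrt C D B1 ((*\<^sub>R) l ` B2))
      \<longrightarrow> additive_wrt (one_sided_polar p C) (one_sided_polar p D)
            (one_sided_polar p B1) (one_sided_polar p B2)) \<and>
     (cs_closed (weak_topology p) (B2 + C) \<and>
         (\<exists>G\<subseteq>B1. pre_cs_compact (weak_topology p) G \<and>
            (\<forall>b\<in>B1. \<forall>r::real>0. (\<lambda>g. b - r *\<^sub>R g) ` G \<inter> (B2 + C) \<noteq> {}))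
      \<longrightarrow> ((\<forall>l::real>1. coadditive_wrt C D B1 ((*\<^sub>R) l ` B2)) \<longleftrightarrow>
           additive_wrt (one_sided_polar p C) (one_sided_polar p D)
             (one_sided_polar p B1) (one_sided_polar p B2))) \<and>
     (closedin (weak_topology p) (B2 + C)
      \<longrightarrow> (coadditive_wrt C D B1 B2 \<longleftrightarrow>
             (\<forall>l::real>1. coadditive_wrt C D B1 ((*\<^sub>R) l ` B2))) \<and>
          ((\<forall>l::real>1. coadditive_wrt C D B1 ((*\<^sub>R) l ` B2)) \<longleftrightarrow>
             additive_wrt (one_sided_polar p C) (one_sided_polar p D)
               (one_sided_polar p B1) (one_sided_polar p B2)))"
proof -
  let ?P = "one_sided_polar p"
  note C = assms(2,3) and D = assms(4,5) and B1 = assms(6-8) and B2 = assms(9-11)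
  have p: "bilinear p" using assms(1) by (simp add: dual_pair_def)
  have "0 \<in> C" using C convex_cone_contains_0 by blast
  have S: "convex (B2 + C)" "0 \<in> B2 + C"
    using convex_set_plus[OF B2(1), of C] C(1) set_plus_intro[OF B2(2) \<open>0 \<in> C\<close>]
    by (simp_all add: convex_cone_def)

  have coadd_imp_add: "additive_wrt C D B1 B2"
    if "coadditive_wrt (?P C) (?P D) (?P B1) (?P B2)"
    by (rule additive_if_polar_coadditive) fact+
  have add_imp_coadd: "coadditive_wrt (?P C) (?P D) (?P B1) (?P B2)"
    if "closedin (weak_topology (\<lambda>z y. p y z)) (?P B2 + ?P C)" "additive_wrt C D B1 B2"
    by (rule polar_coadditive_if_additive) fact+
  have dilated_imp_polar: "additive_wrt (?P C) (?P D) (?P B1) (?P B2)"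
    if "\<forall>l::real>1. coadditive_wrt C D B1 ((*\<^sub>R) l ` B2)"
    using that by (intro polar_additive_if_dilated_coadditive p C(1) D(1)) blast
  have bip: "B1 \<subseteq> one_sided_polar (\<lambda>z y. p y z) (?P (B2 + C)) \<inter> D"
    if "additive_wrt (?P C) (?P D) (?P B1) (?P B2)"
    by (rule bipolar_coadditive_if_polar_additive) fact+
  have cs_case: "coadditive_wrt C D B1 ((*\<^sub>R) l ` B2)"
    if cs: "cs_closed (weak_topology p) (B2 + C)"
      and G_ex: "\<exists>G\<subseteq>B1. pre_cs_compact (weak_topology p) G \<and>
            (\<forall>b\<in>B1. \<forall>r::real>0. (\<lambda>g. b - r *\<^sub>R g) ` G \<inter> (B2 + C) \<noteq> {})"
      and add: "additive_wrt (?P C) (?P D) (?P B1) (?P B2)" and l: "l > 1" for l :: real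
  proof -
    obtain G where G: "G \<subseteq> B1" "pre_cs_compact (weak_topology p) G"
      "\<forall>b\<in>B1. \<forall>r::real>0. (\<lambda>g. b - r *\<^sub>R g) ` G \<inter> (B2 + C) \<noteq> {}"
      using G_ex by blast
    have "B1 \<subseteq> (*\<^sub>R) l ` (B2 + C)"
      using G(3) by (intro cs_closed_absorbs_dilate[OF p cs G(1,2) _ l]) blast
    then show ?thesis
      using bip[OF add] scaled_add_cone[OF C(1), of l B2] l
      by (simp add: coadditive_wrt_def)
  qed
  have closed_case: "coadditive_wrt C D B1 B2"
    if "closedin (weak_topology p) (B2 + C)" "additive_wrt (?P C) (?P D) (?P B1) (?P B2)"
    using bip[OF that(2)] bipolar_eq[OF p S that(1)] by (simp add: coadditive_wrt_def)
  have dilate: "\<forall>l::real>1. coadditive_wrt C D B1 ((*\<^sub>R) l ` B2)"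
    if "coadditive_wrt C D B1 B2"
    using coadditive_wrt_dilate[OF that B2(1,2)] by blast
  show ?thesis
    using coadd_imp_add add_imp_coadd dilated_imp_polar cs_case closed_case dilate by meson
qed

end
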